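(* Let $G$ be a locally compact abelian group. Then a subset of $G$ is coarsely bounded if and only if it is relatively compact; that is, $\mathcal{CB}(G)=\mathcal K(G)$.
   Context: For a topological group $G$, $\mathcal K(G)$ denotes the family of all relatively compact subsets of $G$, i.e. those $A\subseteq G$ whose closure in $G$ is compact. A pseudometric $d$ on a group $G$ is left-invariant if $d(kg,kh)=d(g,h)$ for all $g,h,k\in G$. $\mathcal{CB}(G)$ denotes the family of all coarsely bounded subsets of $G$, i.e. those $A\subseteq G$ such that $\operatorname{diam}_d(A)<\infty$ for every continuous left-invariant pseudometric $d$ on $G$. *)

theory Defs
  imports "HOL-Analysis.Analysis"
begin

text \<open>
  Groups are written additively, via the (not necessarily commutative, not necessarily Hausdorff)
  class \<^class>\<open>topological_group_add\<close>.
\<close>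

text \<open>Nonnegativity follows from these axioms: $0 = d(x,x) \le d(x,y) + d(y,x) = 2 d(x,y)$.\<close>

definition pseudometric :: "('a \<Rightarrow> 'a \<Rightarrow> real) \<Rightarrow> bool" where
  "pseudometric d \<longleftrightarrow>
     (\<forall>x. d x x = 0) \<and> (\<forall>x y. d x y = d y x) \<and> (\<forall>x y z. d x z \<le> d x y + d y z)"

definition left_invariant :: "('a::group_add \<Rightarrow> 'a \<Rightarrow> real) \<Rightarrow> bool" where
  "left_invariant d \<longleftrightarrow> (\<forall>g h k. d (k + g) (k + h) = d g h)"

text \<open>The library's \<^const>\<open>diameter\<close> only concerns the metric of a metric-space type, and it is
  real-valued, so that an unbounded set gets no infinite value.\<close>

definition diam :: "('a \<Rightarrow> 'a \<Rightarrow> real) \<Rightarrow> 'a set \<Rightarrow> ennreal" where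
  "diam d A = (SUP (x, y)\<in>A \<times> A. ennreal (d x y))"

definition coarsely_bounded :: "'a::topological_group_add set \<Rightarrow> bool" where
  "coarsely_bounded A \<longleftrightarrow>
     (\<forall>d. pseudometric d \<and> left_invariant d \<and> continuous_on UNIV (\<lambda>(x, y). d x y)
        \<longrightarrow> diam d A < \<infinity>)"

definition relatively_compact :: "'a::topological_space set \<Rightarrow> bool" where
  "relatively_compact A \<longleftrightarrow> compact (closure A)"

end

theory Submission
  imports Defs
begin

text \<open>
  If \<open>closure A\<close> is compact, then a continuous pseudometric is bounded on
  \<open>closure A \<times> closure A\<close>. The content is the converse, proved by contraposition: a set \<open>A\<close> that is not
  relatively compact must be unbounded for some continuous left-invariant pseudometric. In an abelian
  group such pseudometrics arise from seminorms \<open>L\<close>, by \<open>d x y = L (y - x)\<close>.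

  Fix a symmetric compact neighbourhood \<open>K\<close> of \<open>0\<close>. No finite union of translates of \<open>K\<close> covers \<open>A\<close>, so
  \<open>A\<close> contains a sequence \<open>a\<close> with \<open>a n - a i \<notin> K\<close> for \<open>i < n\<close>; no compact set contains all its terms. There
  is a chain \<open>U k\<close> (\<open>k\<close> an integer) of symmetric neighbourhoods of \<open>0\<close> with
  \<open>U k + U k + U k \<subseteq> U (k + 1)\<close>, compact for \<open>k \<ge> 0\<close>, whose union \<open>H\<close> contains every \<open>a n\<close>: for negative
  \<open>k\<close> it comes from continuity of addition, for positive \<open>k\<close> from adding three copies of the previous set
  and inserting one more term of the sequence (\<open>scale_around\<close>).

  The Birkhoff--Kakutani construction, carried out over all integers, turns the chain into a seminorm
  \<open>l\<close> on the subgroup \<open>H\<close> with \<open>l \<le> 2 powi k\<close> on \<open>U k\<close> and \<open>{l < 2 powi k} \<subseteq> U k\<close>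
  (\<open>seminorm_on_scale\<close>). The small scales make \<open>l\<close> continuous, and the large ones put its balls inside
  compact sets, so \<open>l\<close> is unbounded on the sequence.

  It remains to pass from \<open>H\<close> to the whole group, and this is where commutativity is essential:
  a seminorm on any subgroup of an abelian group extends, with unchanged values, to the whole group, by
  Zorn's lemma as for the Hahn--Banach theorem (\<open>seminorm_on_extend\<close>). Since the \<open>U k\<close> are
  neighbourhoods of \<open>0\<close> in the whole group, the extension is automatically continuous.

  Both the seminorm on \<open>H\<close> and the one-element step of its extension are word lengths: the
  cheapest way of writing a group element as a sum of generators that carry prescribed costs.
\<close>

section \<open>Seminorms and word lengths\<close>

definition seminorm_on :: "'a::ab_group_add set \<Rightarrow> ('a \<Rightarrow> real) \<Rightarrow> bool" where
  "seminorm_on H l \<longleftrightarrow>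
     0 \<in> H \<and> (\<forall>x\<in>H. - x \<in> H) \<and> (\<forall>x\<in>H. \<forall>y\<in>H. x + y \<in> H) \<and>
     l 0 = 0 \<and> (\<forall>x\<in>H. l (- x) = l x) \<and> (\<forall>x\<in>H. \<forall>y\<in>H. l (x + y) \<le> l x + l y)"

lemma seminorm_on_nonneg:
  assumes "seminorm_on H l" "x \<in> H"
  shows "0 \<le> l x"
proof -
  have "l (x + - x) \<le> l x + l (- x)" "l (- x) = l x" "l 0 = 0"
    using assms unfolding seminorm_on_def by blast+
  then show ?thesis by simp
qed

definition word_value :: "('a::ab_group_add \<times> real) list \<Rightarrow> 'a" where
  "word_value ws = sum_list (map fst ws)"

definition word_cost :: "('a \<times> real) list \<Rightarrow> real" where
  "word_cost ws = sum_list (map snd ws)"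

text \<open>
  A generator is a pair of a group element and its cost. Costs are attached to pairs, not to elements,
  so that one element may be offered at several prices and the infimum selects the cheapest.
\<close>

definition word_length :: "('a::ab_group_add \<times> real) set \<Rightarrow> 'a \<Rightarrow> real" where
  "word_length S g = Inf {word_cost ws | ws. set ws \<subseteq> S \<and> word_value ws = g}"

definition word_span :: "('a::ab_group_add \<times> real) set \<Rightarrow> 'a set" where
  "word_span S = {word_value ws | ws. set ws \<subseteq> S}"

lemma word_value_simps [simp]:
  "word_value [] = 0" "word_value (w # ws) = fst w + word_value ws"
  "word_value (us @ vs) = word_value us + word_value vs"
  by (simp_all add: word_value_def)

lemma word_cost_simps [simp]:
  "word_cost [] = 0" "word_cost (w # ws) = snd w + word_cost ws"
  "word_cost (us @ vs) = word_cost us + word_cost vs"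
  by (simp_all add: word_cost_def)

lemma word_cost_nonneg:
  assumes "\<forall>w\<in>S. 0 \<le> snd w" "set ws \<subseteq> S"
  shows "0 \<le> word_cost ws"
  using assms(2) by (induction ws) (use assms(1) in auto)

lemma word_length_le:
  assumes "\<forall>w\<in>S. 0 \<le> snd w" "set ws \<subseteq> S"
  shows "word_length S (word_value ws) \<le> word_cost ws"
  unfolding word_length_def
  by (rule cInf_lower) (use assms in \<open>auto intro!: bdd_belowI[of _ 0] word_cost_nonneg[OF assms(1)]\<close>)

lemma word_length_generator_le:
  assumes "\<forall>w\<in>S. 0 \<le> snd w" "(g, c) \<in> S"
  shows "word_length S g \<le> c"
  using word_length_le[OF assms(1), where ws = "[(g, c)]"] assms(2) by simp

text \<open>
  The infimum of the empty set of reals has no useful value, so lower bounds for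
  \<open>word_length\<close> concern the span only.
\<close>

lemma word_length_greatest:
  assumes "g \<in> word_span S"
    and "\<And>ws. set ws \<subseteq> S \<Longrightarrow> word_value ws = g \<Longrightarrow> r \<le> word_cost ws"
  shows "r \<le> word_length S g"
  unfolding word_length_def
  by (rule cInf_greatest) (use assms in \<open>auto simp: word_span_def\<close>)

lemma word_inverse:
  assumes sym: "\<forall>w\<in>S. (- fst w, snd w) \<in> S" and "set ws \<subseteq> S"
  obtains vs where "set vs \<subseteq> S" "word_value vs = - word_value ws" "word_cost vs = word_cost ws"
proof -
  have "\<exists>vs. set vs \<subseteq> S \<and> word_value vs = - word_value ws \<and> word_cost vs = word_cost ws"
    using assms(2)
  proof (induction ws)
    case Nil
    show ?case by (rule exI[of _ "[]"]) simp
  next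
    case (Cons w ws)
    then obtain vs where "set vs \<subseteq> S" "word_value vs = - word_value ws" "word_cost vs = word_cost ws"
      by auto
    then show ?case
      using Cons.prems sym
      by (intro exI[of _ "(- fst w, snd w) # vs"]) auto
  qed
  then show ?thesis using that by blast
qed

text \<open>
  Concatenating words adds their costs, which gives subadditivity; negating every letter preserves
  the cost, which gives symmetry.
\<close>

lemma seminorm_on_word_length:
  assumes pos: "\<forall>w\<in>S. 0 \<le> snd w"
    and sym: "\<forall>w\<in>S. (- fst w, snd w) \<in> S"
  shows "seminorm_on (word_span S) (word_length S)"
proof -
  have zero: "0 \<in> word_span S"
    unfolding word_span_def by (rule CollectI, rule exI[of _ "[]"]) simp
  have plus: "x + y \<in> word_span S" if "x \<in> word_span S" "y \<in> word_span S" for x y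
  proof -
    from that obtain us vs where "set us \<subseteq> S" "set vs \<subseteq> S" "x = word_value us" "y = word_value vs"
      unfolding word_span_def by blast
    then show ?thesis
      unfolding word_span_def by (intro CollectI exI[of _ "us @ vs"]) simp
  qed
  have minus: "- x \<in> word_span S" if "x \<in> word_span S" for x
  proof -
    from that obtain ws where ws: "set ws \<subseteq> S" "x = word_value ws"
      unfolding word_span_def by blast
    obtain vs where "set vs \<subseteq> S" "word_value vs = - word_value ws" "word_cost vs = word_cost ws"
      by (rule word_inverse[OF sym ws(1)])
    then show ?thesis
      unfolding word_span_def by (intro CollectI exI[of _ vs]) (simp add: ws(2))
  qed
  have minus_le: "word_length S (- x) \<le> word_length S x" if "x \<in> word_span S" for x
  proof (rule word_length_greatest[OF that])
    fix ws assume ws: "set ws \<subseteq> S" "word_value ws = x"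
    obtain vs where "set vs \<subseteq> S" "word_value vs = - word_value ws" "word_cost vs = word_cost ws"
      by (rule word_inverse[OF sym ws(1)])
    then show "word_length S (- x) \<le> word_cost ws"
      using word_length_le[OF pos, where ws = vs] ws by simp
  qed
  have minus_eq: "word_length S (- x) = word_length S x" if "x \<in> word_span S" for x
    using minus_le[OF that] minus_le[OF minus[OF that]] by simp
  have add_le: "word_length S (x + y) \<le> word_length S x + word_length S y"
    if x: "x \<in> word_span S" and y: "y \<in> word_span S" for x y
  proof -
    have "word_length S (x + y) - word_length S y \<le> word_length S x"
    proof (rule word_length_greatest[OF x])
      fix us assume us: "set us \<subseteq> S" "word_value us = x"
      have "word_length S (x + y) - word_cost us \<le> word_length S y"
      proof (rule word_length_greatest[OF y])
        fix vs assume vs: "set vs \<subseteq> S" "word_value vs = y"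
        show "word_length S (x + y) - word_cost us \<le> word_cost vs"
          using word_length_le[OF pos, where ws = "us @ vs"] us vs by simp
      qed
      then show "word_length S (x + y) - word_length S y \<le> word_cost us" by simp
    qed
    then show ?thesis by simp
  qed
  have "word_length S 0 \<le> 0"
    using word_length_le[OF pos, where ws = "[]"] by simp
  moreover have "0 \<le> word_length S 0"
    by (rule word_length_greatest[OF zero]) (rule word_cost_nonneg[OF pos])
  ultimately show ?thesis
    unfolding seminorm_on_def using zero plus minus minus_eq add_le by auto
qed

section \<open>Extension of seminorms\<close>

primrec multiple :: "nat \<Rightarrow> 'a::ab_group_add \<Rightarrow> 'a" where
  "multiple 0 x = 0"
| "multiple (Suc n) x = x + multiple n x"

lemma multiple_add: "multiple (m + n) x = multiple m x + multiple n x"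
  by (induction m) (simp_all add: algebra_simps)

lemma multiple_mult: "multiple (m * n) x = multiple m (multiple n x)"
  by (induction m) (simp_all add: multiple_add)

lemma seminorm_on_multiple:
  assumes "seminorm_on H l" "x \<in> H"
  shows "multiple n x \<in> H \<and> l (multiple n x) \<le> n * l x"
proof (induction n)
  case 0
  then show ?case using assms by (simp add: seminorm_on_def)
next
  case (Suc n)
  have "l (x + multiple n x) \<le> l x + l (multiple n x)" "x + multiple n x \<in> H"
    using assms Suc unfolding seminorm_on_def by blast+
  then show ?case using Suc by (simp add: algebra_simps)
qed

text \<open>
  This bounds the seminorm on those multiples of \<open>x\<close> that happen to lie in \<open>H\<close>. They are the multiples of
  a single one, \<open>multiple m x\<close> with \<open>m\<close> least, so subadditivity bounds them all. Integer
  multiples are written as differences \<open>multiple i x - multiple j x\<close>, in the shape in which counting the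
  letters \<open>x\<close> and \<open>- x\<close> of a word produces them. The constant \<open>c\<close> is a price for \<open>x\<close> so high that
  detours through \<open>x\<close> never shorten a path between points of \<open>H\<close>.
\<close>

lemma seminorm_on_linear_growth:
  assumes sn: "seminorm_on H l"
  obtains c :: real where "0 \<le> c"
    "\<forall>i j. multiple i x - multiple j x \<in> H \<longrightarrow> l (multiple i x - multiple j x) \<le> real (i + j) * c"
proof -
  have l0: "l 0 = 0" and lm: "\<And>y. y \<in> H \<Longrightarrow> l (- y) = l y" and Hm: "\<And>y. y \<in> H \<Longrightarrow> - y \<in> H"
    and Hp: "\<And>y z. y \<in> H \<Longrightarrow> z \<in> H \<Longrightarrow> y + z \<in> H"
    using sn unfolding seminorm_on_def by blast+
  have "\<exists>c\<ge>0::real. \<forall>n. multiple n x \<in> H \<longrightarrow> l (multiple n x) \<le> real n * c"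
  proof (cases "\<exists>m>0. multiple m x \<in> H")
    case False
    then have "n = 0" if "multiple n x \<in> H" for n using that by auto
    then show ?thesis using l0 by (intro exI[of _ 0]) fastforce
  next
    case True
    define m where "m = (LEAST m. m > 0 \<and> multiple m x \<in> H)"
    have m: "m > 0" "multiple m x \<in> H"
      using LeastI_ex[OF True] unfolding m_def by auto
    have least: "m \<le> k" if "k > 0" "multiple k x \<in> H" for k
      unfolding m_def by (rule Least_le) (use that in blast)
    define y where "y = multiple m x"
    have c0: "0 \<le> l y" using seminorm_on_nonneg[OF sn] m by (simp add: y_def)
    have "l (multiple n x) \<le> n * l y" if n: "multiple n x \<in> H" for n
    proof -
      have split: "multiple n x = multiple (n div m) y + multiple (n mod m) x"
        unfolding y_def using multiple_add[of "n div m * m" "n mod m" x]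
        by (simp add: multiple_mult)
      have q: "multiple (n div m) y \<in> H" "l (multiple (n div m) y) \<le> (n div m) * l y"
        using seminorm_on_multiple[OF sn, of y "n div m"] m by (simp_all add: y_def)
      have "multiple (n mod m) x = multiple n x + - multiple (n div m) y"
        using split by simp
      then have "multiple (n mod m) x \<in> H"
        using Hp[OF n Hm[OF q(1)]] by simp
      then have "n mod m = 0"
        using least[of "n mod m"] m(1) by (meson mod_less_divisor not_gr_zero not_le)
      then have "l (multiple n x) \<le> (n div m) * l y" using split q(2) by simp
      also have "\<dots> \<le> n * l y" using c0 by (intro mult_right_mono) simp_all
      finally show ?thesis .
    qed
    then show ?thesis using c0 by (intro exI[of _ "l y"]) simp
  qed
  then obtain c where c: "0 \<le> c" "\<And>n. multiple n x \<in> H \<Longrightarrow> l (multiple n x) \<le> real n * c"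
    by blast
  \<comment> \<open>By symmetry of the seminorm, only \<open>j \<le> i\<close> needs the bound for natural multiples.\<close>
  have *: "l (multiple i x - multiple j x) \<le> real (i + j) * c"
    if "j \<le> i" "multiple i x - multiple j x \<in> H" for i j
  proof -
    have eq: "multiple i x - multiple j x = multiple (i - j) x"
      using multiple_add[of "i - j" j x] that by simp
    then have "l (multiple i x - multiple j x) \<le> real (i - j) * c" using c(2)[of "i - j"] that(2) unfolding eq by blast
    also have "\<dots> \<le> real (i + j) * c" using c(1) by (intro mult_right_mono) simp_all
    finally show ?thesis .
  qed
  have "l (multiple i x - multiple j x) \<le> real (i + j) * c"
    if H: "multiple i x - multiple j x \<in> H" for i j
  proof (cases "j \<le> i")
    case True
    then show ?thesis using * H by blast
  next
    case False
    have "multiple j x - multiple i x \<in> H" "l (multiple j x - multiple i x) = l (multiple i x - multiple j x)"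
      using Hm[OF H] lm[OF H] by simp_all
    then show ?thesis using *[of i j] False by (simp add: add.commute)
  qed
  then show ?thesis using that c(1) by blast
qed

text \<open>
  The new seminorm is the word length for the elements of \<open>H\<close> at their old price \<open>l\<close> and for \<open>x\<close> and
  \<open>- x\<close> at the price \<open>c\<close> of the preceding lemma. Because the group is abelian, the letters of a word can
  be sorted, so every word costs at least as much as one of the form
  \<open>h + multiple i x - multiple j x\<close>; if this lies in \<open>H\<close>, so does the part made of multiples of \<open>x\<close>, and the choice
  of \<open>c\<close> shows that no word beats the old value.
\<close>

lemma seminorm_on_extend_by_element:
  assumes sn: "seminorm_on H l"
  obtains H' l' where "seminorm_on H' l'" "insert x H \<subseteq> H'" "\<forall>h\<in>H. l' h = l h"
proof -
  have l0: "l 0 = 0" and H0: "0 \<in> H" and lm: "\<And>y. y \<in> H \<Longrightarrow> l (- y) = l y"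
    and Hm: "\<And>y. y \<in> H \<Longrightarrow> - y \<in> H"
    and Hp: "\<And>y z. y \<in> H \<Longrightarrow> z \<in> H \<Longrightarrow> y + z \<in> H"
    and lp: "\<And>y z. y \<in> H \<Longrightarrow> z \<in> H \<Longrightarrow> l (y + z) \<le> l y + l z"
    using sn unfolding seminorm_on_def by blast+
  obtain c :: real where c: "0 \<le> c"
    "\<forall>i j. multiple i x - multiple j x \<in> H \<longrightarrow> l (multiple i x - multiple j x) \<le> real (i + j) * c"
    by (rule seminorm_on_linear_growth[OF sn, of x])
  define S where "S = (\<lambda>h. (h, l h)) ` H \<union> {(x, c), (- x, c)}"
  have pos: "\<forall>w\<in>S. 0 \<le> snd w"
    using c(1) seminorm_on_nonneg[OF sn] by (auto simp: S_def)
  have sym: "\<forall>w\<in>S. (- fst w, snd w) \<in> S"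
    using Hm lm by (force simp: S_def image_iff)
  have normal_form: "\<exists>h\<in>H. \<exists>i j. word_value ws = h + multiple i x - multiple j x \<and>
      l h + real (i + j) * c \<le> word_cost ws" if "set ws \<subseteq> S" for ws
    using that
  proof (induction ws)
    case Nil
    show ?case
      by (rule bexI[OF _ H0], rule exI[of _ 0], rule exI[of _ 0]) (simp add: l0)
  next
    case (Cons w ws)
    then obtain h i j where h: "h \<in> H" and eq: "word_value ws = h + multiple i x - multiple j x"
      and le: "l h + real (i + j) * c \<le> word_cost ws" by auto
    from Cons.prems consider k where "k \<in> H" "w = (k, l k)" | "w = (x, c)" | "w = (- x, c)"
      by (auto simp: S_def)
    then show ?case
    proof cases
      case 1
      then show ?thesis using h eq le Hp[of k h] lp[of k h]
        by (intro bexI[of _ "k + h"] exI[of _ i] exI[of _ j]) (auto simp: algebra_simps)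
    next
      case 2
      then show ?thesis using h eq le
        by (intro bexI[of _ h] exI[of _ "Suc i"] exI[of _ j]) (auto simp: algebra_simps)
    next
      case 3
      then show ?thesis using h eq le
        by (intro bexI[of _ h] exI[of _ i] exI[of _ "Suc j"]) (auto simp: algebra_simps)
    qed
  qed
  have span: "s \<in> word_span S" if "(s, b) \<in> S" for s b
    unfolding word_span_def by (intro CollectI exI[of _ "[(s, b)]"]) (use that in simp)
  have agree: "\<forall>g\<in>H. word_length S g = l g"
  proof (intro ballI antisym)
    fix g assume g: "g \<in> H"
    show "word_length S g \<le> l g"
      by (rule word_length_generator_le[OF pos]) (use g in \<open>auto simp: S_def\<close>)
    show "l g \<le> word_length S g"
    proof (rule word_length_greatest)
      show "g \<in> word_span S"
        by (rule span[of g "l g"]) (use g in \<open>auto simp: S_def\<close>)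
      fix ws assume "set ws \<subseteq> S" "word_value ws = g"
      then obtain h i j where h: "h \<in> H" and eq: "g = h + multiple i x - multiple j x"
        and le: "l h + real (i + j) * c \<le> word_cost ws"
        using normal_form by blast
      have "multiple i x - multiple j x = g + - h" using eq by (simp add: algebra_simps)
      then have H: "multiple i x - multiple j x \<in> H" using Hp[OF g Hm[OF h]] by simp
      have "l g \<le> l h + l (multiple i x - multiple j x)"
        using lp[OF h H] eq by (simp add: add_diff_eq)
      also have "\<dots> \<le> l h + real (i + j) * c" using c(2)[rule_format, OF H] by simp
      finally show "l g \<le> word_cost ws" using le by simp
    qed
  qed
  have subset: "insert x H \<subseteq> word_span S"
    using span by (auto simp: S_def)
  show ?thesis
    by (rule that[OF seminorm_on_word_length[OF pos sym] subset agree])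
qed

text \<open>
  Zorn's lemma for the partial seminorms extending \<open>l\<close>, ordered by inclusion of their graphs. Each
  clause of \<open>seminorm_on\<close> involves at most two elements of the domain, and any two elements of the union of a
  chain of graphs already lie in one member, so the union is again the graph of a seminorm.
\<close>

lemma seminorm_on_extend:
  assumes sn: "seminorm_on H l"
  obtains L where "seminorm_on UNIV L" "\<forall>h\<in>H. L h = l h"
proof -
  define graph :: "'a set \<Rightarrow> ('a \<Rightarrow> real) \<Rightarrow> ('a \<times> real) set"
    where "graph = (\<lambda>H l. (\<lambda>h. (h, l h)) ` H)"
  have graph_iff: "(x, a) \<in> graph H l \<longleftrightarrow> x \<in> H \<and> a = l x" for x a H l
    by (auto simp: graph_def)
  define P where "P = {p. graph H l \<subseteq> p \<and> (\<exists>H' l'. seminorm_on H' l' \<and> p = graph H' l')}"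
  have "\<exists>M\<in>P. \<forall>X\<in>P. M \<subseteq> X \<longrightarrow> X = M"
  proof (rule subset_Zorn_nonempty)
    show "P \<noteq> {}" using sn by (auto simp: P_def)
    fix C assume C: "C \<noteq> {}" "subset.chain P C"
    have graphs: "\<exists>H' l'. seminorm_on H' l' \<and> p = graph H' l'" if "p \<in> C" for p
      using C(2) that by (auto simp: subset.chain_def P_def)
    have common: "\<exists>H' l'. seminorm_on H' l' \<and> graph H' l' \<in> C \<and> u \<in> graph H' l' \<and> v \<in> graph H' l'"
      if uv: "u \<in> \<Union>C" "v \<in> \<Union>C" for u v
    proof -
      from uv obtain p q where pq: "p \<in> C" "q \<in> C" "u \<in> p" "v \<in> q" by blast
      then have "p \<subseteq> q \<or> q \<subseteq> p" using C(2) by (auto simp: subset_chain_def)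
      then obtain r where "r \<in> C" "u \<in> r" "v \<in> r" using pq by blast
      then show ?thesis using graphs by metis
    qed
    define D where "D = fst ` \<Union>C"
    define m where "m = (\<lambda>x. SOME a. (x, a) \<in> \<Union>C)"
    have m_eq: "x \<in> D \<and> m x = a" if "(x, a) \<in> \<Union>C" for x a
    proof -
      have "(x, m x) \<in> \<Union>C" unfolding m_def by (rule someI, rule that)
      from common[OF this that] show ?thesis using that by (force simp: graph_iff D_def)
    qed
    have D_m: "(x, m x) \<in> \<Union>C" if x: "x \<in> D" for x
    proof -
      obtain u where "u \<in> \<Union>C" "x = fst u" using x unfolding D_def by blast
      then have "(x, snd u) \<in> \<Union>C" by simp
      then show ?thesis using m_eq by metis
    qed
    have two: "\<exists>H' l'. seminorm_on H' l' \<and> x \<in> H' \<and> y \<in> H' \<and> H' \<subseteq> D \<and> (\<forall>z\<in>H'. m z = l' z)"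
      if xy: "x \<in> D" "y \<in> D" for x y
    proof -
      obtain H' l' where *: "seminorm_on H' l'" "graph H' l' \<in> C" "(x, m x) \<in> graph H' l'"
        "(y, m y) \<in> graph H' l'" using common[OF D_m[OF xy(1)] D_m[OF xy(2)]] by blast
      have "z \<in> D \<and> m z = l' z" if "z \<in> H'" for z
        by (rule m_eq) (use * that in \<open>auto simp: graph_def\<close>)
      then show ?thesis using * by (auto simp: graph_iff)
    qed
    have "seminorm_on D m"
      unfolding seminorm_on_def
    proof (intro conjI ballI)
      obtain p where "p \<in> C" using C(1) by blast
      then obtain H' l' where *: "seminorm_on H' l'" "graph H' l' \<in> C" using graphs by blast
      from *(1) have "0 \<in> H'" "l' 0 = 0" unfolding seminorm_on_def by blast+
      then have "(0, 0) \<in> graph H' l'" by (simp add: graph_iff)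
      then have "(0, 0) \<in> \<Union>C" using *(2) by blast
      then show "0 \<in> D" "m 0 = 0" using m_eq by blast+
    next
      fix x assume "x \<in> D"
      then obtain H' l' where *: "seminorm_on H' l'" "x \<in> H'" "H' \<subseteq> D" "\<forall>z\<in>H'. m z = l' z"
        using two[of x x] by blast
      then have "- x \<in> H'" "l' (- x) = l' x" unfolding seminorm_on_def by blast+
      then show "- x \<in> D" "m (- x) = m x" using * by auto
    next
      fix x y assume "x \<in> D" "y \<in> D"
      then obtain H' l' where *: "seminorm_on H' l'" "x \<in> H'" "y \<in> H'" "H' \<subseteq> D"
        "\<forall>z\<in>H'. m z = l' z"
        using two[of x y] by blast
      then have "x + y \<in> H'" "l' (x + y) \<le> l' x + l' y" unfolding seminorm_on_def by blast+
      then show "x + y \<in> D" "m (x + y) \<le> m x + m y" using * by auto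
    qed
    moreover have "\<Union>C = graph D m"
      using m_eq D_m by (auto simp: graph_def)
    moreover have "graph H l \<subseteq> \<Union>C"
      using C by (fastforce simp: subset.chain_def P_def)
    ultimately show "\<Union>C \<in> P" by (auto simp: P_def)
  qed
  then obtain M where M: "M \<in> P" "\<And>X. X \<in> P \<Longrightarrow> M \<subseteq> X \<Longrightarrow> X = M" by blast
  then obtain D m where Dm: "seminorm_on D m" "M = graph D m" "graph H l \<subseteq> graph D m"
    by (auto simp: P_def)
  have "x \<in> D" for x
  proof -
    obtain H' l' where *: "seminorm_on H' l'" "insert x D \<subseteq> H'" "\<forall>h\<in>D. l' h = m h"
      by (rule seminorm_on_extend_by_element[OF Dm(1), of x])
    have "graph D m \<subseteq> graph H' l'" using *(2,3) by (auto simp: graph_def)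
    then have "graph H' l' = graph D m"
      using M(2)[of "graph H' l'"] Dm(2,3) *(1) by (auto simp: P_def)
    moreover have "(x, l' x) \<in> graph H' l'" using *(2) by (simp add: graph_iff)
    ultimately show ?thesis by (simp add: graph_iff)
  qed
  then have "D = UNIV" by blast
  then have "seminorm_on UNIV m" using Dm(1) by simp
  moreover have "\<forall>h\<in>H. m h = l h" using Dm(3) by (auto simp: graph_def)
  ultimately show ?thesis by (rule that)
qed

section \<open>Seminorms from a chain of neighbourhoods\<close>

text \<open>
  The letter \<open>z\<close> is the one at which the partial sums first reach \<open>t\<close>, or the last one. For \<open>t\<close> half the total, the
  parts before and after \<open>z\<close> both have sum at most \<open>t\<close>.
\<close>

lemma split_list_at_partial_sum:
  fixes f :: "'b \<Rightarrow> real"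
  assumes "xs \<noteq> []" "0 \<le> t"
  shows "\<exists>ys z zs. xs = ys @ z # zs \<and> sum_list (map f ys) \<le> t \<and>
           (zs = [] \<or> t \<le> sum_list (map f ys) + f z)"
  using assms
proof (induction xs arbitrary: t)
  case (Cons x xs)
  show ?case
  proof (cases "xs = [] \<or> t \<le> f x")
    case True
    then show ?thesis using Cons.prems
      by (intro exI[of _ "[]"] exI[of _ x] exI[of _ xs]) auto
  next
    case False
    then obtain ys z zs where *: "xs = ys @ z # zs" "sum_list (map f ys) \<le> t - f x"
      "zs = [] \<or> t - f x \<le> sum_list (map f ys) + f z" using Cons.IH[of "t - f x"] by auto
    then show ?thesis using False
      by (intro exI[of _ "x # ys"] exI[of _ z] exI[of _ zs]) auto
  qed
qed simp

text \<open>
  The combinatorial core of the Birkhoff--Kakutani theorem. A word of cost below \<open>2 powi n\<close> is cut at half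
  its cost into two shorter words and a middle letter. The two words cost less than
  \<open>2 powi (n - 1)\<close> and so have values in \<open>U (n - 1)\<close> by induction; the letter costs less than
  \<open>2 powi n\<close>, and as prices are powers of two, it lies in \<open>U (n - 1)\<close> as well. Three such terms sum to an
  element of \<open>U n\<close>.
\<close>

lemma word_value_in_scale:
  fixes U :: "int \<Rightarrow> 'a::ab_group_add set"
  assumes zero: "\<And>k. 0 \<in> U k"
    and triple: "\<And>k x y z. x \<in> U k \<Longrightarrow> y \<in> U k \<Longrightarrow> z \<in> U k \<Longrightarrow> x + y + z \<in> U (k + 1)"
    and "set ws \<subseteq> {(g, 2 powi k) | g k. g \<in> U k}" "word_cost ws < 2 powi n"
  shows "word_value ws \<in> U n"
  using assms(3,4)
proof (induction ws arbitrary: n rule: length_induct)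
  case (1 ws)
  define S where "S = {(g, 2 powi k :: real) | g k. g \<in> U k}"
  have pos: "\<forall>w\<in>S. 0 \<le> snd w" by (auto simp: S_def)
  have mono: "U i \<subseteq> U j" if "i \<le> j" for i j
    using that
  proof (induction j rule: int_ge_induct)
    case (step j)
    then show ?case using triple[of _ j 0 0] zero by auto
  qed simp
  show ?case
  proof (cases "ws = []")
    case True
    then show ?thesis using zero by simp
  next
    case False
    define t where "t = word_cost ws / 2"
    have t0: "0 \<le> t"
      using word_cost_nonneg[OF pos] 1(2) by (simp add: t_def S_def)
    have tn: "t < 2 powi (n - 1)"
      using 1(3) by (simp add: t_def power_int_diff)
    obtain us w vs where ws: "ws = us @ w # vs" and us: "word_cost us \<le> t"
      and w: "vs = [] \<or> t \<le> word_cost us + snd w"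
      using split_list_at_partial_sum[OF False t0, of snd] unfolding word_cost_def by auto
    have sub: "set us \<subseteq> S" "set vs \<subseteq> S" "w \<in> S" using 1(2) ws by (auto simp: S_def)
    have vs: "word_cost vs \<le> t"
      using w t0 by (auto simp: t_def ws)
    have us_vs: "word_value us \<in> U (n - 1)" "word_value vs \<in> U (n - 1)"
      using 1(1) sub us vs tn ws by (auto simp: S_def)
    obtain g k where gk: "w = (g, 2 powi k)" "g \<in> U k" using sub(3) by (auto simp: S_def)
    have "2 powi k \<le> word_cost ws"
      using word_cost_nonneg[OF pos sub(1)] word_cost_nonneg[OF pos sub(2)] gk ws by simp
    then have "(2::real) powi k < 2 powi n" using 1(3) by simp
    then have "k < n"
      by (metis linorder_not_less one_le_numeral power_int_increasing)
    then have "g \<in> U (n - 1)" using gk mono[of k "n - 1"] by auto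
    then show ?thesis
      using triple[of "word_value us" "n - 1" g "word_value vs"] us_vs gk ws by (simp add: add.assoc)
  qed
qed

lemma seminorm_on_scale:
  fixes U :: "int \<Rightarrow> 'a::ab_group_add set"
  assumes zero: "\<And>k. 0 \<in> U k"
    and sym: "\<And>k x. x \<in> U k \<Longrightarrow> - x \<in> U k"
    and triple: "\<And>k x y z. x \<in> U k \<Longrightarrow> y \<in> U k \<Longrightarrow> z \<in> U k \<Longrightarrow> x + y + z \<in> U (k + 1)"
  obtains l where "seminorm_on (\<Union>k. U k) l"
    "\<forall>k. \<forall>x\<in>U k. l x \<le> 2 powi k"
    "\<forall>k. \<forall>x\<in>(\<Union>k. U k). l x < 2 powi k \<longrightarrow> x \<in> U k"
proof -
  define S where "S = {(g, 2 powi k :: real) | g k. g \<in> U k}"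
  have pos: "\<forall>w\<in>S. 0 \<le> snd w" by (auto simp: S_def)
  have symS: "\<forall>w\<in>S. (- fst w, snd w) \<in> S" using sym by (auto simp: S_def)
  have inU: "word_value ws \<in> U n" if "set ws \<subseteq> S" "word_cost ws < 2 powi n" for ws n
    using word_value_in_scale[of U, OF zero triple] that unfolding S_def by blast
  have span: "word_span S = (\<Union>k. U k)"
  proof
    show "word_span S \<subseteq> (\<Union>k. U k)"
    proof
      fix x assume "x \<in> word_span S"
      then obtain ws where ws: "set ws \<subseteq> S" "x = word_value ws" by (auto simp: word_span_def)
      obtain n where "word_cost ws < 2 ^ n" using real_arch_pow[of 2] by auto
      then show "x \<in> (\<Union>k. U k)" using inU[of ws "int n"] ws by auto
    qed
    show "(\<Union>k. U k) \<subseteq> word_span S"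
    proof
      fix x assume "x \<in> (\<Union>k. U k)"
      then obtain k where "x \<in> U k" by blast
      then show "x \<in> word_span S"
        unfolding word_span_def
        by (intro CollectI exI[of _ "[(x, 2 powi k)]"]) (auto simp: S_def)
    qed
  qed
  show ?thesis
  proof (rule that)
    show "seminorm_on (\<Union>k. U k) (word_length S)"
      using seminorm_on_word_length[OF pos symS] span by simp
    show "\<forall>k. \<forall>x\<in>U k. word_length S x \<le> 2 powi k"
    proof (intro allI ballI)
      fix k x assume "x \<in> U k"
      then have "(x, 2 powi k) \<in> S" by (auto simp: S_def)
      then show "word_length S x \<le> 2 powi k" by (rule word_length_generator_le[OF pos])
    qed
    show "\<forall>k. \<forall>x\<in>(\<Union>k. U k). word_length S x < 2 powi k \<longrightarrow> x \<in> U k"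
    proof (intro allI ballI impI, rule ccontr)
      fix k x assume x: "x \<in> (\<Union>k. U k)" "word_length S x < 2 powi k"
      assume "x \<notin> U k"
      then have "2 powi k \<le> word_length S x"
        by (intro word_length_greatest) (use x span inU in \<open>auto simp: not_less[symmetric]\<close>)
      then show False using x by simp
    qed
  qed
qed

section \<open>Compactness in topological abelian groups\<close>

lemma triple_sum_neighbourhood:
  fixes N :: "'a::topological_ab_group_add set"
  assumes "0 \<in> interior N"
  obtains V where "open V" "0 \<in> V" "\<forall>x\<in>V. - x \<in> V"
    "\<forall>x\<in>V. \<forall>y\<in>V. \<forall>z\<in>V. x + y + z \<in> N"
proof -
  define T where "T = (\<lambda>p::'a \<times> 'a \<times> 'a. fst p + fst (snd p) + snd (snd p)) -` interior N"
  have "open T"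
    unfolding T_def by (rule open_vimage[OF open_interior]) (intro continuous_intros)
  moreover have "(0, 0, 0) \<in> T"
    using assms by (simp add: T_def)
  ultimately obtain P Q where P: "open P" "0 \<in> P" and Q: "open Q" "(0, 0) \<in> Q" and PQ: "P \<times> Q \<subseteq> T"
    by (rule open_prod_elim) auto
  from Q obtain Q1 Q2 where Q12: "open Q1" "0 \<in> Q1" "open Q2" "0 \<in> Q2" "Q1 \<times> Q2 \<subseteq> Q"
    by (rule open_prod_elim) auto
  define W where "W = P \<inter> Q1 \<inter> Q2"
  have W: "open W" "0 \<in> W"
    using P Q12 by (auto simp: W_def)
  have sum: "x + y + z \<in> N" if "x \<in> W" "y \<in> W" "z \<in> W" for x y z
  proof -
    have "(x, y, z) \<in> T" using that PQ Q12(5) unfolding W_def by blast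
    then show ?thesis using interior_subset[of N] by (auto simp: T_def)
  qed
  have "open (uminus -` W)"
    by (rule open_vimage[OF W(1)]) (intro continuous_intros)
  then show ?thesis
    using W sum by (intro that[of "W \<inter> uminus -` W"]) auto
qed

lemma open_translate:
  fixes V :: "'a::topological_ab_group_add set"
  assumes "open V"
  shows "open {y. y - x \<in> V}"
  using open_vimage[OF assms, of "\<lambda>y. y - x"] by (simp add: vimage_def continuous_intros)

lemma compact_sums:
  fixes A B :: "'a::topological_ab_group_add set"
  assumes "compact A" "compact B"
  shows "compact {x + y | x y. x \<in> A \<and> y \<in> B}"
proof -
  have "{x + y | x y. x \<in> A \<and> y \<in> B} = (\<lambda>p. fst p + snd p) ` (A \<times> B)" by force
  then show ?thesis
    using compact_continuous_image[OF _ compact_Times[OF assms], of "\<lambda>p. fst p + snd p"]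
    by (simp add: continuous_intros)
qed

text \<open>
  In a space that is not Hausdorff, compact sets need not be closed, so that \<open>A \<subseteq> C\<close> does not give
  \<open>closure A \<subseteq> C\<close>. Translating by a compact neighbourhood of \<open>0\<close> repairs this: \<open>closure A \<subseteq> C + K\<close>, which
  is compact.
\<close>

lemma relatively_compact_subset_compact:
  fixes A C K :: "'a::topological_ab_group_add set"
  assumes "A \<subseteq> C" "compact C" "compact K" "0 \<in> interior K"
  shows "relatively_compact A"
proof -
  have "closure A \<subseteq> {x + y | x y. x \<in> C \<and> y \<in> K}"
  proof
    fix x assume x: "x \<in> closure A"
    have "open {y. x - y \<in> interior K}"
      using open_vimage[OF open_interior, of "\<lambda>y. x - y" K] by (simp add: vimage_def continuous_intros)
    moreover have "x \<in> {y. x - y \<in> interior K} \<inter> closure A"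
      using x assms(4) by simp
    ultimately have "{y. x - y \<in> interior K} \<inter> A \<noteq> {}"
      using open_Int_closure_eq_empty by blast
    then obtain y where y: "y \<in> A" "x - y \<in> interior K" by blast
    then have "x = y + (x - y)" "y \<in> C" "x - y \<in> K"
      using assms(1) interior_subset[of K] by auto
    then show "x \<in> {x + y | x y. x \<in> C \<and> y \<in> K}" by blast
  qed
  then have "closure A \<inter> {x + y | x y. x \<in> C \<and> y \<in> K} = closure A" by blast
  then show ?thesis
    unfolding relatively_compact_def
    using closed_Int_compact[OF closed_closure[of A] compact_sums[OF assms(2,3)]] by simp
qed

lemma separated_sequence_in_non_relatively_compact:
  fixes A K :: "'a::topological_ab_group_add set"
  assumes "\<not> relatively_compact A" "compact K" "0 \<in> interior K"
  obtains a :: "nat \<Rightarrow> 'a" where "\<forall>n. a n \<in> A" "\<forall>n. \<forall>i<n. a n - a i \<notin> K"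
proof -
  have ex: "\<exists>r\<in>A. \<forall>f\<in>F. r - f \<notin> K" if "finite F" for F
  proof (rule ccontr)
    assume "\<not> ?thesis"
    then have *: "\<forall>r\<in>A. \<exists>f\<in>F. r - f \<in> K" by blast
    have "A \<subseteq> {x + y | x y. x \<in> F \<and> y \<in> K}"
    proof
      fix r assume "r \<in> A"
      then obtain f where "f \<in> F" "r - f \<in> K" "r = f + (r - f)" using * by auto
      then show "r \<in> {x + y | x y. x \<in> F \<and> y \<in> K}" by blast
    qed
    then show False
      using relatively_compact_subset_compact compact_sums[OF finite_imp_compact[OF that] assms(2)]
        assms by blast
  qed
  have "\<exists>a. \<forall>n::nat. a n \<in> A \<and> (\<forall>i<n. a n - a i \<notin> K)"
  proof (rule dependent_wellorder_choice)
    fix n :: nat and a :: "nat \<Rightarrow> 'a"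
    show "\<exists>r. r \<in> A \<and> (\<forall>i<n. r - a i \<notin> K)"
      using ex[of "a ` {..<n}"] by auto
  qed auto
  then show ?thesis using that by blast
qed

text \<open>
  A compact set is covered by finitely many translates of \<open>V\<close>, for an open symmetric \<open>V\<close> with
  \<open>V - V \<subseteq> K\<close>; two terms of the sequence in the same translate differ by an element of \<open>K\<close>.
\<close>

lemma separated_sequence_not_in_compact:
  fixes a :: "nat \<Rightarrow> 'a::topological_ab_group_add"
  assumes sep: "\<And>i n. i < n \<Longrightarrow> a n - a i \<notin> K" and K: "0 \<in> interior K" and "compact C"
  shows "\<not> range a \<subseteq> C"
proof
  assume C: "range a \<subseteq> C"
  obtain V where V: "open V" "0 \<in> V" "\<forall>x\<in>V. - x \<in> V"
    "\<forall>x\<in>V. \<forall>y\<in>V. \<forall>z\<in>V. x + y + z \<in> K"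
    by (rule triple_sum_neighbourhood[OF K])
  have "C \<subseteq> (\<Union>c\<in>C. {y. y - c \<in> V})" using V(2) by auto
  then obtain F where F: "F \<subseteq> C" "finite F" "C \<subseteq> (\<Union>c\<in>F. {y. y - c \<in> V})"
    using compactE_image[OF assms(3), of C "\<lambda>c. {y. y - c \<in> V}"] open_translate[OF V(1)] by metis
  then have "\<forall>n. \<exists>c\<in>F. a n - c \<in> V" using C by blast
  then obtain c where c: "\<And>n. c n \<in> F" "\<And>n. a n - c n \<in> V" by metis
  have "\<not> inj c"
    using F(2) c(1) by (metis finite_imageD finite_subset image_subsetI infinite_UNIV_nat)
  then obtain i n where "i < n" "c i = c n"
    by (metis injI linorder_neqE_nat)
  moreover have "(a n - c n) + - (a i - c i) + 0 \<in> K" using V c by blast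
  ultimately show False using sep[of i n] by (simp add: algebra_simps)
qed

section \<open>Coarsely bounded sets\<close>

lemma continuous_seminorm:
  fixes L :: "'a::topological_ab_group_add \<Rightarrow> real"
  assumes sn: "seminorm_on UNIV L"
    and small: "\<And>e. e > 0 \<Longrightarrow> \<exists>V. open V \<and> 0 \<in> V \<and> (\<forall>x\<in>V. L x < e)"
  shows "continuous_on UNIV L"
proof -
  have Lm: "L (- x) = L x" and Lp: "L (x + y) \<le> L x + L y" for x y
    using sn unfolding seminorm_on_def by blast+
  have diff: "\<bar>L y - L x\<bar> \<le> L (y - x)" for x y
    using Lp[of "y - x" x] Lp[of "x - y" y] Lm[of "y - x"] by simp
  have "(L \<longlongrightarrow> L x) (at x)" for x
  proof (rule tendstoI)
    fix e :: real assume "e > 0"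
    then obtain V where V: "open V" "0 \<in> V" "\<And>x. x \<in> V \<Longrightarrow> L x < e" using small[OF \<open>e > 0\<close>] by blast
    show "\<forall>\<^sub>F y in at x. dist (L y) (L x) < e"
      unfolding eventually_at_topological
    proof (intro exI conjI ballI impI)
      show "open {y. y - x \<in> V}" "x \<in> {y. y - x \<in> V}"
        using open_translate[OF V(1)] V(2) by simp_all
      fix y assume "y \<in> {y. y - x \<in> V}"
      then show "dist (L y) (L x) < e"
        using V(3)[of "y - x"] diff[of y x] by (simp add: dist_real_def)
    qed
  qed
  then show ?thesis by (simp add: continuous_on_def)
qed

lemma pseudometric_of_seminorm:
  fixes L :: "'a::topological_ab_group_add \<Rightarrow> real"
  assumes sn: "seminorm_on UNIV L" and "continuous_on UNIV L"
  shows "pseudometric (\<lambda>x y. L (y - x))" "left_invariant (\<lambda>x y. L (y - x))"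
    "continuous_on UNIV (\<lambda>(x, y). L (y - x))"
proof -
  have L0: "L 0 = 0" and Lm: "L (- x) = L x" and Lp: "L (x + y) \<le> L x + L y" for x y
    using sn unfolding seminorm_on_def by blast+
  have sym: "L (y - x) = L (x - y)" for x y using Lm[of "y - x"] by simp
  have tri: "L (z - x) \<le> L (y - x) + L (z - y)" for x y z using Lp[of "y - x" "z - y"] by simp
  show "pseudometric (\<lambda>x y. L (y - x))"
    unfolding pseudometric_def by (intro conjI allI sym tri) (simp add: L0)
  show "left_invariant (\<lambda>x y. L (y - x))" by (simp add: left_invariant_def)
  show "continuous_on UNIV (\<lambda>(x, y). L (y - x))"
    unfolding case_prod_beta
    by (rule continuous_on_compose2[OF assms(2)]) (auto intro!: continuous_intros)
qed

lemma finite_diam_bound: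
  assumes "diam d A < \<infinity>"
  obtains R where "\<forall>x\<in>A. \<forall>y\<in>A. d x y \<le> R"
proof -
  obtain R where R: "diam d A = ennreal R" "0 \<le> R"
    using assms by (cases "diam d A") auto
  have "d x y \<le> R" if "x \<in> A" "y \<in> A" for x y
  proof -
    have "ennreal (d x y) \<le> diam d A"
      unfolding diam_def using that by (intro SUP_upper2[of "(x, y)"]) auto
    then show ?thesis using R by (simp add: ennreal_le_iff)
  qed
  then show ?thesis using that by blast
qed

lemma relatively_compact_imp_coarsely_bounded:
  fixes A :: "'a::topological_group_add set"
  assumes "relatively_compact A"
  shows "coarsely_bounded A"
  unfolding coarsely_bounded_def
proof (intro allI impI, elim conjE)
  fix d :: "'a \<Rightarrow> 'a \<Rightarrow> real"
  assume "continuous_on UNIV (\<lambda>(x, y). d x y)"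
  then have "continuous_on (closure A \<times> closure A) (\<lambda>(x, y). d x y)"
    by (rule continuous_on_subset) simp
  then have "compact ((\<lambda>(x, y). d x y) ` (closure A \<times> closure A))"
    using assms unfolding relatively_compact_def
    by (intro compact_continuous_image compact_Times)
  then have "bounded ((\<lambda>(x, y). d x y) ` (closure A \<times> closure A))"
    by (rule compact_imp_bounded)
  then obtain R where R: "\<forall>x\<in>closure A. \<forall>y\<in>closure A. \<bar>d x y\<bar> \<le> R"
    by (auto simp: bounded_real)
  have le: "d x y \<le> R" if "x \<in> A" "y \<in> A" for x y
    using R closure_subset[of A] that by (meson abs_le_D1 subsetD)
  have "diam d A \<le> ennreal R"
    unfolding diam_def by (intro SUP_least) (auto intro!: ennreal_leI le)
  then show "diam d A < \<infinity>"
    by (metis ennreal_less_top infinity_ennreal_def le_less_trans)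
qed

text \<open>
  Nonnegative indices are filled by a recursion upwards from \<open>K\<close>, which remains compact because each step
  adds only two points to a sum of compact sets; negative indices by a choice of ever
  smaller neighbourhoods downwards from \<open>K\<close>. The two halves meet at \<open>U 0 = K\<close>.
\<close>

lemma scale_around:
  fixes a :: "nat \<Rightarrow> 'a::topological_ab_group_add" and K :: "'a set"
  assumes K: "compact K" "0 \<in> interior K" "\<And>x. x \<in> K \<Longrightarrow> - x \<in> K"
  obtains U :: "int \<Rightarrow> 'a set" where
    "\<forall>k. 0 \<in> interior (U k)" "\<forall>k. \<forall>x\<in>U k. - x \<in> U k"
    "\<forall>k. \<forall>x\<in>U k. \<forall>y\<in>U k. \<forall>z\<in>U k. x + y + z \<in> U (k + 1)"
    "\<forall>k\<ge>0. compact (U k)" "range a \<subseteq> (\<Union>k. U k)"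
proof -
  define B where "B = rec_nat K (\<lambda>n X. {u + z | u z. u \<in> {x + y | x y. x \<in> X \<and> y \<in> X} \<and> z \<in> X}
    \<union> {a n, - a n})"
  have B0: "B 0 = K" and BS: "B (Suc n) = {u + z | u z. u \<in> {x + y | x y. x \<in> B n \<and> y \<in> B n} \<and> z \<in> B n}
    \<union> {a n, - a n}" for n by (simp_all add: B_def)
  have B_compact: "compact (B n)" for n
  proof (induction n)
    case (Suc n)
    then show ?case unfolding BS by (intro compact_Un compact_sums) auto
  qed (simp add: B0 K)
  have B_triple: "x + y + z \<in> B (Suc n)" if "x \<in> B n" "y \<in> B n" "z \<in> B n" for x y z n
    using that unfolding BS by blast
  have B_int: "0 \<in> interior (B n)" for n
  proof (induction n)
    case (Suc n)
    then have "0 \<in> B n" using interior_subset by blast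
    then have "B n \<subseteq> B (Suc n)" using B_triple[of _ n 0 0] by auto
    then show ?case using Suc interior_mono by blast
  qed (simp add: B0 K)
  have B_sym: "- x \<in> B n" if "x \<in> B n" for x n
    using that
  proof (induction n arbitrary: x)
    case (Suc n)
    then consider x1 x2 x3 where "x = x1 + x2 + x3" "x1 \<in> B n" "x2 \<in> B n" "x3 \<in> B n"
      | "x = a n" | "x = - a n" unfolding BS by blast
    then show ?case
    proof cases
      case 1
      then have "- x1 + - x2 + - x3 \<in> B (Suc n)" using Suc.IH B_triple by blast
      then show ?thesis using 1 by (simp add: algebra_simps)
    qed (simp_all add: BS)
  qed (simp add: B0 K)
  have a_B: "a n \<in> B (Suc n)" for n by (simp add: BS)
  \<comment> \<open>The clause for \<open>n = 0\<close> fixes the start of the descending sequence at \<open>K\<close>.\<close>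
  have "\<exists>V. \<forall>n::nat. (0 \<in> interior (V n) \<and> (\<forall>x\<in>V n. - x \<in> V n) \<and> (n = 0 \<longrightarrow> V n = K)) \<and>
      (\<forall>x\<in>V (Suc n). \<forall>y\<in>V (Suc n). \<forall>z\<in>V (Suc n). x + y + z \<in> V n)"
  proof (rule dependent_nat_choice)
    fix N :: "'a set" and n :: nat
    assume "0 \<in> interior N \<and> (\<forall>x\<in>N. - x \<in> N) \<and> (n = 0 \<longrightarrow> N = K)"
    then have "0 \<in> interior N" by blast
    then obtain V where "open V" "0 \<in> V" "\<forall>x\<in>V. - x \<in> V"
      "\<forall>x\<in>V. \<forall>y\<in>V. \<forall>z\<in>V. x + y + z \<in> N"
      by (rule triple_sum_neighbourhood)
    then show "\<exists>V. (0 \<in> interior V \<and> (\<forall>x\<in>V. - x \<in> V) \<and> (Suc n = 0 \<longrightarrow> V = K)) \<and>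
        (\<forall>x\<in>V. \<forall>y\<in>V. \<forall>z\<in>V. x + y + z \<in> N)"
      by (intro exI[of _ V]) (auto simp: interior_open)
  qed (use K in auto)
  then obtain V where V: "\<And>n::nat. 0 \<in> interior (V n)" "\<And>n x. x \<in> V n \<Longrightarrow> - x \<in> V n" "V 0 = K"
    "\<And>n x y z. x \<in> V (Suc n) \<Longrightarrow> y \<in> V (Suc n) \<Longrightarrow> z \<in> V (Suc n) \<Longrightarrow> x + y + z \<in> V n"
    by metis
  define U where "U = (\<lambda>k. if k \<ge> 0 then B (nat k) else V (nat (- k)))"
  show ?thesis
  proof (rule that[of U])
    have "x + y + z \<in> U (k + 1)" if "x \<in> U k" "y \<in> U k" "z \<in> U k" for k x y z
    proof (cases "k \<ge> 0")
      case True
      then show ?thesis using that B_triple[of x "nat k" y z] by (simp add: U_def nat_add_distrib)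
    next
      case False
      define m where "m = nat (- k - 1)"
      have m: "nat (- k) = Suc m" "k + 1 = - int m" using False by (auto simp: m_def)
      then have "x + y + z \<in> V m" using that False V(4)[of x m y z] by (simp add: U_def)
      then show ?thesis using m V(3) B0 by (cases "m = 0") (auto simp: U_def)
    qed
    then show "\<forall>k. \<forall>x\<in>U k. \<forall>y\<in>U k. \<forall>z\<in>U k. x + y + z \<in> U (k + 1)" by blast
    have "a n \<in> U (int (Suc n))" for n using a_B[of n] unfolding U_def nat_int by simp
    then show "range a \<subseteq> (\<Union>k. U k)" by blast
  qed (use B_int B_sym B_compact V in \<open>auto simp: U_def split: if_splits\<close>)
qed

lemma coarsely_bounded_imp_relatively_compact:
  fixes A K :: "'a::topological_ab_group_add set"
  assumes A: "coarsely_bounded A" and K: "compact K" "0 \<in> interior K" "\<And>x. x \<in> K \<Longrightarrow> - x \<in> K"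
  shows "relatively_compact A"
proof (rule ccontr)
  assume "\<not> relatively_compact A"
  then obtain a :: "nat \<Rightarrow> 'a" where a: "\<forall>n. a n \<in> A" "\<forall>n. \<forall>i<n. a n - a i \<notin> K"
    using K(1,2) by (rule separated_sequence_in_non_relatively_compact)
  obtain U :: "int \<Rightarrow> 'a set" where U: "\<forall>k. 0 \<in> interior (U k)" "\<forall>k. \<forall>x\<in>U k. - x \<in> U k"
    "\<forall>k. \<forall>x\<in>U k. \<forall>y\<in>U k. \<forall>z\<in>U k. x + y + z \<in> U (k + 1)"
    "\<forall>k\<ge>0. compact (U k)" "range a \<subseteq> (\<Union>k. U k)"
    by (rule scale_around[OF K, of a])
  note U = this[rule_format]
  have U0: "0 \<in> U k" for k using U(1) interior_subset by blast
  obtain l where l: "seminorm_on (\<Union>k. U k) l" "\<forall>k. \<forall>x\<in>U k. l x \<le> 2 powi k"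
    "\<forall>k. \<forall>x\<in>(\<Union>k. U k). l x < 2 powi k \<longrightarrow> x \<in> U k"
    by (rule seminorm_on_scale[of U, OF U0 U(2,3)])
  obtain L where L: "seminorm_on UNIV L" "\<forall>h\<in>(\<Union>k. U k). L h = l h"
    by (rule seminorm_on_extend[OF l(1)])
  have "continuous_on UNIV L"
  proof (rule continuous_seminorm[OF L(1)])
    fix e :: real assume "e > 0"
    then obtain n where "(1 / 2) ^ n < e" using real_arch_pow_inv[of e "1 / 2"] by auto
    then have "2 powi (- int n) < e" by (simp add: power_int_minus power_one_over inverse_eq_divide)
    moreover have "L x \<le> 2 powi (- int n)" if "x \<in> interior (U (- int n))" for x
    proof -
      have "x \<in> U (- int n)" using that interior_subset by blast
      then show ?thesis using L(2) l(2) by auto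
    qed
    ultimately show "\<exists>V. open V \<and> 0 \<in> V \<and> (\<forall>x\<in>V. L x < e)"
      using U(1) by (intro exI[of _ "interior (U (- int n))"]) (auto intro: le_less_trans)
  qed
  then have "diam (\<lambda>x y. L (y - x)) A < \<infinity>"
    using A pseudometric_of_seminorm[OF L(1)] unfolding coarsely_bounded_def by blast
  then obtain R where R: "\<forall>x\<in>A. \<forall>y\<in>A. L (y - x) \<le> R"
    by (rule finite_diam_bound)
  obtain N where N: "R + L (a 0) < 2 ^ N" using real_arch_pow[of 2] by auto
  have "a n \<in> U (int N)" for n
  proof -
    have aU: "a n \<in> (\<Union>k. U k)" using U(5) by blast
    have "L (a n) \<le> L (a n - a 0) + L (a 0)"
      using L(1) unfolding seminorm_on_def by (metis UNIV_I diff_add_cancel)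
    then have "L (a n) < 2 powi (int N)" using R[rule_format, of "a 0" "a n"] a(1) N by simp
    then have "l (a n) < 2 powi (int N)" using L(2) aU by metis
    then show ?thesis using l(3)[rule_format, OF aU] by blast
  qed
  then have "range a \<subseteq> U (int N)" by blast
  moreover have "compact (U (int N))" using U(4) by simp
  ultimately show False
    using separated_sequence_not_in_compact[of a K "U (int N)"] a(2) K(2) by blast
qed

theorem theorem1p1:
  assumes "locally_compact_space (euclidean :: 'a::topological_ab_group_add topology)"
  shows "{A :: 'a set. coarsely_bounded A} = {A :: 'a set. relatively_compact A}"
proof -
  have "\<forall>x::'a. \<exists>W. open W \<and> (\<exists>C. compact C \<and> x \<in> W \<and> W \<subseteq> C)"
    using assms by (simp add: locally_compact_space_def)
  then obtain W C :: "'a set" where C: "open W" "compact C" "0 \<in> W" "W \<subseteq> C"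
    by metis
  \<comment> \<open>The union with the mirror image is used, since without the Hausdorff property an
    intersection of compact sets can fail to be compact.\<close>
  define K where "K = C \<union> uminus ` C"
  have "compact K"
    unfolding K_def using C(2) by (intro compact_Un compact_continuous_image continuous_intros)
  moreover have "0 \<in> interior K"
    using C interior_maximal[of W K] by (auto simp: K_def)
  moreover have "- x \<in> K" if "x \<in> K" for x using that by (auto simp: K_def)
  ultimately show ?thesis
    using coarsely_bounded_imp_relatively_compact relatively_compact_imp_coarsely_bounded by blast
qed

end
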